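(* For all integers $n\ge 1$ and any integer partition $\lambda$, the independence polynomial of the pineapple graph $Pi(n,\lambda)$ is log-concave.
   Context: For a partition $\lambda=(\lambda_1,\ldots,\lambda_\ell)$, the spider $S(\lambda)$ is the tree consisting of a vertex (the torso) together with $\ell$ pairwise disjoint paths (legs) having $\lambda_1,\ldots,\lambda_\ell$ vertices respectively, where one end vertex of each leg is joined by an edge to the torso. The pineapple graph $Pi(n,\lambda)$ is the graph obtained by identifying a vertex of the complete graph $K_n$ with the torso of $S(\lambda)$ (so for $n=1$ it is $S(\lambda)$ itself). For a finite simple graph $G$, the independence polynomial is $I_G(t)=\sum_{j=0}^{\alpha(G)} i_jt^j$, where $i_j$ is the number of independent sets of $G$ of cardinality $j$ ($i_0=1$) and $\alpha(G)$ is the maximum size of an independent set. A polynomial $a_0+a_1t+\cdots+a_dt^d$ is log-concave if $a_j^2\ge a_{j-1}a_{j+1}$ for all $1\le j\le d-1$. *)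

theory Defs
  imports "Graph_Theory.Kuratowski" "HOL-Computational_Algebra.Polynomial"
begin

text \<open>Finite simple graphs are the \<^locale>\<open>pair_graph\<close>s of the library: an edge between
  \<open>u\<close> and \<open>v\<close> is represented by both arcs \<open>(u, v)\<close> and \<open>(v, u)\<close>.\<close>

definition independent_sets :: "'a pair_pre_digraph \<Rightarrow> 'a set set" where
  "independent_sets G = {S. S \<subseteq> pverts G \<and> (\<forall>u\<in>S. \<forall>v\<in>S. (u, v) \<notin> parcs G)}"

definition independence_number :: "'a pair_pre_digraph \<Rightarrow> nat" where
  "independence_number G = Max (card ` independent_sets G)"

definition independence_poly :: "'a pair_pre_digraph \<Rightarrow> int poly" where
  "independence_poly G =
     (\<Sum>j\<le>independence_number G. monom (int (card {S \<in> independent_sets G. card S = j})) j)"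

definition log_concave_poly :: "'a :: linordered_idom poly \<Rightarrow> bool" where
  "log_concave_poly p \<longleftrightarrow>
     (\<forall>j. 1 \<le> j \<and> j < degree p \<longrightarrow> coeff p (j - 1) * coeff p (j + 1) \<le> (coeff p j)\<^sup>2)"

text \<open>The empty partition is included; its spider is the single vertex \<open>Torso\<close>.\<close>

definition integer_partition :: "nat list \<Rightarrow> bool" where
  "integer_partition l \<longleftrightarrow> sorted_wrt (\<ge>) l \<and> (\<forall>k\<in>set l. 1 \<le> k)"

text \<open>\<open>Leg i j\<close> is the \<open>j\<close>-th vertex of the \<open>i\<close>-th leg, both counted from 0 and \<open>j\<close> counted
  outwards from the torso. \<open>Clique i\<close> is a vertex of the complete graph other than the torso.\<close>

datatype pineapple_vertex = Torso | Leg nat nat | Clique nat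

definition spider :: "nat list \<Rightarrow> pineapple_vertex pair_pre_digraph" where
  "spider l =
     (let E = {(Torso, Leg i 0) | i. i < length l \<and> 0 < l ! i}
            \<union> {(Leg i j, Leg i (Suc j)) | i j. i < length l \<and> Suc j < l ! i}
      in \<lparr> pverts = insert Torso {Leg i j | i j. i < length l \<and> j < l ! i},
           parcs = E \<union> E\<inverse> \<rparr>)"

definition complete_graph_on :: "'a set \<Rightarrow> 'a pair_pre_digraph" where
  "complete_graph_on V = \<lparr> pverts = V, parcs = {(u, v). u \<in> V \<and> v \<in> V \<and> u \<noteq> v} \<rparr>"

text \<open>The complete graph below and the spider share exactly the vertex \<open>Torso\<close>, so that
  their union is the graph obtained by identifying a vertex of the former with the torso of
  the latter.\<close>

definition torso_clique :: "nat \<Rightarrow> pineapple_vertex pair_pre_digraph" where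
  "torso_clique n = complete_graph_on (insert Torso (Clique ` {1..<n}))"

definition pineapple :: "nat \<Rightarrow> nat list \<Rightarrow> pineapple_vertex pair_pre_digraph" where
  "pineapple n l =
     \<lparr> pverts = pverts (torso_clique n) \<union> pverts (spider l),
       parcs = parcs (torso_clique n) \<union> parcs (spider l) \<rparr>"

lemma spider_pair_graph: "pair_graph (spider l)"
proof -
  have "{Leg i j | i j. i < length l \<and> j < l ! i} = (\<Union>i<length l. Leg i ` {..<l ! i})"
    by auto
  then have f: "finite (pverts (spider l))"
    by (simp add: spider_def Let_def)
  have s: "parcs (spider l) \<subseteq> pverts (spider l) \<times> pverts (spider l)"
    by (auto simp: spider_def Let_def)
  show ?thesis
  proof
    show "finite (parcs (spider l))"
      using f s by (meson finite_SigmaI finite_subset)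
  next
    show "symmetric (with_proj (spider l))"
      by (auto simp: symmetric_def spider_def Let_def intro: symI)
  qed (use f s in \<open>auto simp: spider_def Let_def\<close>)
qed

lemma complete_graph_on_pair_graph: "finite V \<Longrightarrow> pair_graph (complete_graph_on V)"
proof
  assume V: "finite V"
  show "finite (parcs (complete_graph_on V))"
    using V by (auto simp: complete_graph_on_def intro: finite_subset[of _ "V \<times> V"])
  show "symmetric (with_proj (complete_graph_on V))"
    by (auto simp: symmetric_def complete_graph_on_def intro: symI)
qed (auto simp: complete_graph_on_def)

lemma torso_clique_complete:
  assumes "n \<ge> 1"
  shows "complete_digraph n (with_proj (torso_clique n))"
proof -
  interpret pair_graph "torso_clique n"
    unfolding torso_clique_def by (rule complete_graph_on_pair_graph) simp
  have "card (insert Torso (Clique ` {1..<n})) = n"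
    using assms by (subst card_insert_disjoint) (auto simp: card_image inj_on_def)
  then show ?thesis
    unfolding complete_digraph_pair_def
    by (simp add: torso_clique_def complete_graph_on_def) auto
qed

lemma pineapple_pair_graph: "pair_graph (pineapple n l)"
proof -
  interpret A: pair_graph "torso_clique n"
    unfolding torso_clique_def by (rule complete_graph_on_pair_graph) simp
  interpret B: pair_graph "spider l" by (rule spider_pair_graph)
  show ?thesis
  proof
    show "symmetric (with_proj (pineapple n l))"
      using A.sym_arcs B.sym_arcs
      by (auto simp: symmetric_def pineapple_def sym_Un)
  qed (use A.pair_no_loops B.pair_no_loops A.wellformed B.wellformed in
       \<open>auto simp: pineapple_def dest: A.arc_fst_in_verts A.arc_snd_in_verts
          B.arc_fst_in_verts B.arc_snd_in_verts\<close>)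
qed

lemma torso_clique_inter_spider:
  "pverts (torso_clique n) \<inter> pverts (spider l) = {Torso}"
  by (auto simp: torso_clique_def complete_graph_on_def spider_def Let_def)

lemma pineapple_1: "pineapple 1 l = spider l"
  by (auto simp: pineapple_def torso_clique_def complete_graph_on_def spider_def Let_def)

lemma degree_independence_poly:
  assumes "pair_graph G"
  shows "degree (independence_poly G) = independence_number G"
proof -
  interpret pair_graph G by fact
  let ?c = "\<lambda>j. int (card {S \<in> independent_sets G. card S = j})"
  have fin: "finite (independent_sets G)"
    by (rule finite_subset[of _ "Pow (pverts G)"]) (auto simp: independent_sets_def)
  have "{} \<in> independent_sets G" by (simp add: independent_sets_def)
  then have "independence_number G \<in> card ` independent_sets G"
    unfolding independence_number_def using fin by (intro Max_in) auto
  then have nz: "?c (independence_number G) \<noteq> 0"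
    using fin by auto
  have c: "coeff (independence_poly G) k = (if k \<le> independence_number G then ?c k else 0)" for k
    by (simp add: independence_poly_def coeff_sum)
  show ?thesis
    by (rule antisym) (auto intro: degree_le le_degree simp: c nz simp del: of_nat_eq_0_iff)
qed

end

theory Submission
  imports Defs
begin

text \<open>With \<open>B = (1 + (n - 1) t) \<Prod> F\<^sub>k\<close> and \<open>A = \<Prod> F\<^bsub>k-1\<^esub>\<close>, the products running over the legs and
  \<open>F\<^sub>k\<close> being the independence polynomial of a path with \<open>k\<close> vertices, deleting the torso gives
  \<open>I = B + t A\<close>. Three instances of the likelihood ratio order, namely \<open>B\<close> below \<open>t I\<close>, \<open>A\<close> below \<open>B\<close>
  and \<open>A\<close> below \<open>t A\<close>, add up to log-concavity of \<open>I\<close>. Only the first one is hard.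
  It says that \<open>y B(x) I(y) = y B(x) B(y) + y\<^sup>2 B(x) A(y)\<close> has larger coefficients at
  \<open>x\<^sup>i y\<^sup>j\<close> than at \<open>x\<^sup>j y\<^sup>i\<close> for \<open>i < j\<close>, a property that is stable under multiplication by
  \<open>e\<^sub>1 = x + y\<close> and \<open>e\<^sub>2 = x y\<close>. Each leg contributes a factor \<open>T + x U\<close> to \<open>B(x) A(y)\<close> and a
  factor \<open>S\<close> to \<open>B(x) B(y)\<close>, where \<open>S, T, U\<close> are polynomials in \<open>e\<^sub>1, e\<^sub>2\<close> with nonnegative
  coefficients. After expansion in powers of \<open>x\<close>, the terms \<open>y\<^sup>2 x\<^sup>k\<close> with \<open>k \<ge> 3\<close> are the only harmful
  ones, and \<open>y e\<^sub>2 e\<^sub>1\<^bsup>k-1\<^esup>\<close> compensates for them; the product of the \<open>S\<close> supplies this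
  compensation because every leg splits into pieces with \<open>S = T\<close> or \<open>S = (d e\<^sub>1 + c e\<^sub>2) U\<close>,
  \<open>d \<ge> 1\<close>, \<open>3 c d\<^sup>2 \<ge> 1\<close>, and the AM-GM inequality then gives
  \<open>\<Sum>\<^sub>i c\<^sub>i \<Prod>\<^bsub>j\<noteq>i\<^esub> d\<^sub>j \<ge> 1\<close> for any three or more pieces.\<close>

section \<open>Bivariate polynomials and the dominance property\<close>

text \<open>The inner variable is \<open>x\<close> and the outer one is \<open>y\<close>, so \<open>coeff2 f i j\<close> belongs to \<open>x\<^sup>i y\<^sup>j\<close>.\<close>

type_synonym bipoly = "real poly poly"

definition X :: bipoly where "X = [:[:0, 1:]:]"
definition Y :: bipoly where "Y = [:0, 1:]"
definition e1 :: bipoly where "e1 = X + Y"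
definition e2 :: bipoly where "e2 = X * Y"
definition const :: "real \<Rightarrow> bipoly" where "const r = [:[:r:]:]"

lemma const_add: "const (a + b) = const a + const b"
  by (simp add: const_def)

lemma const_mult: "const (a * b) = const a * const b"
  by (simp add: const_def)

lemma const_0 [simp]: "const 0 = 0"
  by (simp add: const_def)

lemma const_1 [simp]: "const 1 = 1"
  by (simp only: const_def pCons_one)

lemma const_of_nat: "const (of_nat n) = of_nat n"
  by (induction n) (simp_all add: const_add)

text \<open>Integer indices, with value 0 at negative ones, make multiplication by \<open>X\<close>
  or \<open>Y\<close> a plain index shift.\<close>

definition coeff2 :: "bipoly \<Rightarrow> int \<Rightarrow> int \<Rightarrow> real" where
  "coeff2 f i j = (if i < 0 \<or> j < 0 then 0 else coeff (coeff f (nat j)) (nat i))"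

lemma coeff_pCons_0_nat:
  "coeff (pCons 0 p) (nat i) = (if i \<le> 0 then 0 else coeff p (nat (i - 1)))"
proof (cases "i \<le> 0")
  case False
  then have "nat i = Suc (nat (i - 1))" by simp
  with False show ?thesis by simp
qed simp

lemma coeff2_add [simp]: "coeff2 (f + g) i j = coeff2 f i j + coeff2 g i j"
  by (simp add: coeff2_def)

lemma coeff2_uminus [simp]: "coeff2 (- f) i j = - coeff2 f i j"
  by (simp add: coeff2_def)

lemma coeff2_1: "coeff2 1 i j = (if i = 0 \<and> j = 0 then 1 else 0)"
  by (auto simp: coeff2_def)

lemma coeff2_const_mult [simp]: "coeff2 (const r * f) i j = r * coeff2 f i j"
  by (simp add: coeff2_def const_def)

lemma coeff2_X_mult [simp]: "coeff2 (X * f) i j = coeff2 f (i - 1) j"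
  by (auto simp: coeff2_def X_def coeff_pCons_0_nat)

lemma coeff2_Y_mult [simp]: "coeff2 (Y * f) i j = coeff2 f i (j - 1)"
  by (auto simp: coeff2_def Y_def coeff_pCons_0_nat)

lemma coeff2_X_power_mult [simp]: "coeff2 (X ^ n * f) i j = coeff2 f (i - int n) j"
  by (induction n arbitrary: i) (simp_all add: mult.assoc algebra_simps)

lemma coeff2_Y_power_mult [simp]: "coeff2 (Y ^ n * f) i j = coeff2 f i (j - int n)"
  by (induction n arbitrary: j) (simp_all add: mult.assoc algebra_simps)

text \<open>For \<open>f = in_X p * in_Y q\<close> this is the likelihood ratio order,
  \<open>p\<close> below \<open>q\<close>.\<close>

definition dominant :: "bipoly \<Rightarrow> bool" where
  "dominant f \<longleftrightarrow> (\<forall>i j. i < j \<longrightarrow> coeff2 f j i \<le> coeff2 f i j)"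

lemma dominantD: "dominant f \<Longrightarrow> i < j \<Longrightarrow> coeff2 f j i \<le> coeff2 f i j"
  by (simp add: dominant_def)

lemma dominant_le: "dominant f \<Longrightarrow> i \<le> j \<Longrightarrow> coeff2 f j i \<le> coeff2 f i j"
  by (cases "i = j") (simp_all add: dominant_def)

lemma dominant_add: "dominant f \<Longrightarrow> dominant g \<Longrightarrow> dominant (f + g)"
  by (simp add: dominant_def add_mono)

lemma dominant_const_mult: "dominant f \<Longrightarrow> 0 \<le> r \<Longrightarrow> dominant (const r * f)"
  by (simp add: dominant_def mult_left_mono)

lemma dominant_e1_mult: "dominant f \<Longrightarrow> dominant (e1 * f)"
  unfolding dominant_def
proof (intro allI impI)
  fix i j :: int assume f: "\<forall>i j. i < j \<longrightarrow> coeff2 f j i \<le> coeff2 f i j" and "i < j"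
  \<comment> \<open>For \<open>j = i + 1\<close> the pair \<open>(i, j - 1)\<close> lies on the
    diagonal, hence \<open>dominant_le\<close>.\<close>
  then have "i \<le> j - 1" "i - 1 < j" by auto
  then have "coeff2 f (j - 1) i \<le> coeff2 f i (j - 1)" "coeff2 f j (i - 1) \<le> coeff2 f (i - 1) j"
    using f dominant_le[of f i "j - 1"] by (auto simp: dominant_def)
  then show "coeff2 (e1 * f) j i \<le> coeff2 (e1 * f) i j"
    by (simp add: e1_def distrib_right)
qed

lemma dominant_e2_mult: "dominant f \<Longrightarrow> dominant (e2 * f)"
  by (auto simp: dominant_def e2_def mult.assoc)

lemma dominant_Y_power: "dominant (Y ^ n)"
  using coeff2_Y_power_mult[of n 1] by (auto simp: dominant_def coeff2_1)

lemma dominant_uminus_Y_X_power: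
  assumes "1 \<le> n" shows "dominant (- (Y * X ^ n))"
proof -
  have "coeff2 (Y * X ^ n) i j = (if i = int n \<and> j = 1 then 1 else 0)" for i j
    using coeff2_X_power_mult[of n 1] by (auto simp: coeff2_1)
  then show ?thesis using assms by (auto simp: dominant_def)
qed

inductive_set sym_nonneg :: "bipoly set" where
  const: "0 \<le> r \<Longrightarrow> const r \<in> sym_nonneg"
| e1: "e1 \<in> sym_nonneg"
| e2: "e2 \<in> sym_nonneg"
| add: "f \<in> sym_nonneg \<Longrightarrow> g \<in> sym_nonneg \<Longrightarrow> f + g \<in> sym_nonneg"
| mult: "f \<in> sym_nonneg \<Longrightarrow> g \<in> sym_nonneg \<Longrightarrow> f * g \<in> sym_nonneg"

lemma sym_nonneg_0: "0 \<in> sym_nonneg"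
  using sym_nonneg.const[of 0] by simp

lemma sym_nonneg_1: "1 \<in> sym_nonneg"
  using sym_nonneg.const[of 1] by simp

lemma sym_nonneg_of_nat: "of_nat n \<in> sym_nonneg"
  using sym_nonneg.const[of "of_nat n"] by (simp add: const_of_nat)

lemma sym_nonneg_numeral: "numeral n \<in> sym_nonneg"
  using sym_nonneg_of_nat[of "numeral n"] by simp

lemma sym_nonneg_power: "f \<in> sym_nonneg \<Longrightarrow> f ^ n \<in> sym_nonneg"
  by (induction n) (simp_all add: sym_nonneg_1 sym_nonneg.mult)

lemma sym_nonneg_prod: "(\<And>i. i \<in> A \<Longrightarrow> f i \<in> sym_nonneg) \<Longrightarrow> prod f A \<in> sym_nonneg"
  by (induction A rule: infinite_finite_induct) (simp_all add: sym_nonneg_1 sym_nonneg.mult)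

lemmas sym_nonneg_intros = sym_nonneg.const sym_nonneg.e1 sym_nonneg.e2 sym_nonneg.add
  sym_nonneg.mult sym_nonneg_0 sym_nonneg_1 sym_nonneg_of_nat sym_nonneg_numeral
  sym_nonneg_power

lemma dominant_sym_nonneg_mult: "f \<in> sym_nonneg \<Longrightarrow> dominant g \<Longrightarrow> dominant (f * g)"
  by (induction arbitrary: g rule: sym_nonneg.induct)
    (simp_all add: dominant_const_mult dominant_e1_mult dominant_e2_mult dominant_add
      distrib_right mult.assoc)

text \<open>\<open>X\<close> is a root of \<open>z^2 - e1 z + e2\<close>, which gives a two-step
  recurrence for its powers. The leftover \<open>- (Y * X ^ m)\<close> is dominant only for
  \<open>m \<ge> 1\<close>, so \<open>n = 2\<close> is a base case too.\<close>

lemma dominant_Y_X_power_plus_e1_power: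
  "1 \<le> n \<Longrightarrow> dominant (Y * X ^ n + Y * e1 ^ n)"
proof (induction n rule: less_induct)
  case (less n)
  consider "n = 1" | "n = 2" | m where "n = Suc (Suc m)" "1 \<le> m"
    using less.prems by (metis One_nat_def Suc_1 Suc_leI not0_implies_Suc not_gr_zero not_less_eq_eq)
  then show ?case
  proof cases
    case 1
    have "Y * X ^ 1 + Y * e1 ^ 1 = (e2 + e2) * Y ^ 0 + Y ^ 2"
      by (simp add: e1_def e2_def algebra_simps power2_eq_square)
    then show ?thesis unfolding 1
      by (simp only:) (intro dominant_add dominant_sym_nonneg_mult dominant_Y_power sym_nonneg_intros)
  next
    case 2
    have "Y * X ^ 2 + Y * e1 ^ 2 = (2 * (e1 * e2)) * Y ^ 0 + Y ^ 3"
      by (simp add: e1_def e2_def algebra_simps power2_eq_square power3_eq_cube)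
    then show ?thesis unfolding 2
      by (simp only:) (intro dominant_add dominant_sym_nonneg_mult dominant_Y_power sym_nonneg_intros)
  next
    case 3
    have eq: "Y * X ^ n + Y * e1 ^ n =
        e1 * (Y * X ^ Suc m + Y * e1 ^ Suc m) + e2 * - (Y * X ^ m)"
      by (simp add: 3 e1_def e2_def algebra_simps)
    have "dominant (Y * X ^ Suc m + Y * e1 ^ Suc m)"
      using less.IH[of "Suc m"] 3 by simp
    then show ?thesis unfolding eq
      using 3 by (intro dominant_add[OF dominant_e1_mult dominant_e2_mult]
          dominant_uminus_Y_X_power)
  qed
qed

text \<open>For \<open>k \<ge> 3\<close> a factor \<open>e2\<close> splits off and leaves the
  previous sum; for smaller \<open>k\<close> the exponent of \<open>x\<close> does not exceed that
  of \<open>y\<close>.\<close>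

lemma dominant_Y2_X_power:
  "dominant (Y\<^sup>2 * X ^ k + (if 3 \<le> k then Y * e2 * e1 ^ (k - 1) else 0))"
proof (cases "3 \<le> k")
  case True
  then obtain n where k: "k = Suc n" "1 \<le> n" by (cases k) auto
  have "Y\<^sup>2 * X ^ k + Y * e2 * e1 ^ (k - 1) = e2 * (Y * X ^ n + Y * e1 ^ n)"
    by (simp add: k e2_def algebra_simps power2_eq_square)
  with True k show ?thesis
    by (simp add: dominant_e2_mult dominant_Y_X_power_plus_e1_power)
next
  case False
  then have "k = 0 \<or> k = 1 \<or> k = 2" by auto
  moreover have "Y\<^sup>2 * X ^ 1 = e2 * Y ^ 1" "Y\<^sup>2 * X\<^sup>2 = (e2 * e2) * Y ^ 0"
    by (simp_all add: e2_def algebra_simps power2_eq_square)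
  then have "dominant (Y\<^sup>2 * X ^ 1)" "dominant (Y\<^sup>2 * X\<^sup>2)"
    by (simp_all only: dominant_sym_nonneg_mult dominant_Y_power sym_nonneg_intros)
  ultimately show ?thesis using False dominant_Y_power[of 2] by auto
qed

section \<open>Legs and the compensation of harmful terms\<close>

text \<open>\<open>leg s t u\<close> describes a factor \<open>s\<close> of \<open>B(x) B(y)\<close> together with the corresponding factor
  \<open>t + x u\<close> of \<open>B(x) A(y)\<close>. The inequality to be proved is multilinear in these triples, so it
  is enough to treat the generators.\<close>

inductive leg :: "bipoly \<Rightarrow> bipoly \<Rightarrow> bipoly \<Rightarrow> bool" where
  unit: "w \<in> sym_nonneg \<Longrightarrow> leg w w 0"
| linear: "w \<in> sym_nonneg \<Longrightarrow> 1 \<le> d \<Longrightarrow> 0 \<le> c \<Longrightarrow> 1 \<le> 3 * c * d\<^sup>2 \<Longrightarrow>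
    leg ((const d * e1 + const c * e2) * w) 0 w"
| surplus: "w \<in> sym_nonneg \<Longrightarrow> leg w 0 0"
| add: "leg s t u \<Longrightarrow> leg s' t' u' \<Longrightarrow> leg (s + s') (t + t') (u + u')"

lemma leg_sym_nonneg: "leg s t u \<Longrightarrow> s \<in> sym_nonneg \<and> t \<in> sym_nonneg \<and> u \<in> sym_nonneg"
  by (induction rule: leg.induct) (auto intro!: sym_nonneg_intros)

lemma leg_sym_nonneg_mult:
  "leg s t u \<Longrightarrow> w \<in> sym_nonneg \<Longrightarrow> leg (w * s) (w * t) (w * u)"
proof (induction rule: leg.induct)
  case (linear v d c)
  then have "leg ((const d * e1 + const c * e2) * (w * v)) 0 (w * v)"
    by (intro leg.linear sym_nonneg_intros) auto
  then show ?case by (simp add: algebra_simps)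
qed (auto simp: distrib_left intro!: leg.intros sym_nonneg_intros)

text \<open>The constraints satisfied by \<open>D = \<Prod> d\<^sub>i\<close> and \<open>C = \<Sum>\<^sub>i c\<^sub>i \<Prod>\<^bsub>j\<noteq>i\<^esub> d\<^sub>j\<close> for \<open>k\<close> linear pieces; the
  case \<open>k = 2\<close> is what AM-GM needs to reach \<open>C \<ge> 1\<close> in the step to \<open>k = 3\<close>.\<close>

definition admissible :: "nat \<Rightarrow> real \<Rightarrow> real \<Rightarrow> bool" where
  "admissible k D C \<longleftrightarrow> 1 \<le> D \<and> 0 \<le> C \<and>
     (k = 0 \<longrightarrow> C = 0) \<and> (k = 1 \<longrightarrow> 1 \<le> 3 * C * D\<^sup>2) \<and> (k = 2 \<longrightarrow> 4 \<le> 9 * C\<^sup>2 * D) \<and>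
     (3 \<le> k \<longrightarrow> 1 \<le> C)"

lemma admissible_Suc:
  assumes a: "admissible k D C" and d: "1 \<le> d" "0 \<le> c" "1 \<le> 3 * c * d\<^sup>2"
  shows "admissible (Suc k) (D * d) (C * d + D * c)"
proof -
  have D: "1 \<le> D" "0 \<le> C" using a by (auto simp: admissible_def)
  have *: "1 \<le> D * d" "0 \<le> C * d + D * c"
    using D d by (simp_all add: mult_ge1_I)
  consider "k = 0" | "k = 1" | "k = 2" | "3 \<le> k" by linarith
  then show ?thesis
  proof cases
    case 1
    then have C: "C = 0" using a by (simp add: admissible_def)
    have "3 * c * d\<^sup>2 * 1 \<le> 3 * c * d\<^sup>2 * D ^ 3"
      using D d by (intro mult_left_mono) auto
    then have "1 \<le> 3 * (D * c) * (D * d)\<^sup>2"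
      using d by (simp add: power2_eq_square power3_eq_cube algebra_simps)
    then show ?thesis using 1 C * by (simp add: admissible_def)
  next
    case 2
    then have C: "1 \<le> 3 * C * D\<^sup>2" using a by (simp add: admissible_def)
    have "1 * 1 \<le> (3 * C * D\<^sup>2) * (3 * c * d\<^sup>2)"
      using C d by (intro mult_mono) auto
    \<comment> \<open>AM-GM for \<open>C * d\<close> and \<open>D * c\<close>, as
      \<open>(a + b)^2 = (a - b)^2 + 4 a b\<close>.\<close>
    moreover have "0 \<le> (C * d - D * c)\<^sup>2 * (D * d)" using D d by simp
    moreover have "9 * (C * d + D * c)\<^sup>2 * (D * d) =
        9 * ((C * d - D * c)\<^sup>2 * (D * d)) + 4 * ((3 * C * D\<^sup>2) * (3 * c * d\<^sup>2))"
      by (simp add: power2_eq_square algebra_simps)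
    ultimately have "4 \<le> 9 * (C * d + D * c)\<^sup>2 * (D * d)" by linarith
    then show ?thesis using 2 * by (simp add: admissible_def)
  next
    case 3
    then have C: "4 \<le> 9 * C\<^sup>2 * D" using a by (simp add: admissible_def)
    define u where "u = C * d"
    have "C \<noteq> 0" using C by auto
    then have u: "0 < u" using D d by (simp add: u_def)
    have "4 * 1 \<le> (9 * C\<^sup>2 * D) * (3 * c * d\<^sup>2)"
      using C D d by (intro mult_mono) auto
    then have "4 \<le> 27 * u\<^sup>2 * (D * c)" by (simp add: u_def power2_eq_square algebra_simps)
    \<comment> \<open>AM-GM for \<open>u / 2\<close>, \<open>u / 2\<close>, \<open>D * c\<close>:
      the product is \<open>27 u^3 - 27 u^2 + 4\<close>, with a double root at the equality case
      \<open>u = 2 / 3\<close>.\<close>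
    moreover have "0 \<le> (3 * u - 2)\<^sup>2 * (3 * u + 1)" using u by simp
    then have "27 * u\<^sup>2 \<le> 27 * u\<^sup>2 * u + 4"
      by (simp add: power2_eq_square algebra_simps)
    ultimately have "27 * u\<^sup>2 * 1 \<le> 27 * u\<^sup>2 * (u + D * c)"
      by (simp add: algebra_simps)
    then have "1 \<le> C * d + D * c"
      using u unfolding u_def[symmetric] by (subst (asm) mult_le_cancel_left_pos) auto
    then show ?thesis using 3 * by (simp add: admissible_def)
  next
    case 4
    then have "1 \<le> C * d" using a d by (simp add: admissible_def mult_ge1_I)
    moreover have "0 \<le> D * c" using D d by simp
    ultimately show ?thesis using 4 * by (simp add: admissible_def)
  qed
qed

text \<open>\<open>debt t u L k\<close> is the image of \<open>x\<^sup>k \<Prod>\<^bsub>i<L\<^esub> (t\<^sub>i + x u\<^sub>i)\<close> under \<open>x\<^sup>m \<mapsto> e\<^sub>1\<^bsup>m-1\<^esup>\<close> for \<open>m \<ge> 3\<close> and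
  \<open>x\<^sup>m \<mapsto> 0\<close> otherwise, treating \<open>t\<^sub>i\<close> and \<open>u\<^sub>i\<close> as scalars.\<close>

fun debt :: "(nat \<Rightarrow> bipoly) \<Rightarrow> (nat \<Rightarrow> bipoly) \<Rightarrow> nat \<Rightarrow> nat \<Rightarrow> bipoly" where
  "debt t u 0 k = (if 3 \<le> k then e1 ^ (k - 1) else 0)"
| "debt t u (Suc L) k = t L * debt t u L k + u L * debt t u L (Suc k)"

text \<open>\<open>k\<close>, \<open>D\<close>, \<open>C\<close> record the linear pieces chosen so
  far, whose product is kept only up to first order in \<open>e2\<close>. When no leg is left, the
  debt is 0 or \<open>e2 * e1 ^ (k - 1)\<close>, and \<open>C \<ge> 1\<close> covers the
  latter.\<close>

lemma debt_paid:
  assumes "\<And>i. i < L \<Longrightarrow> leg (s i) (t i) (u i)" and "admissible k D C"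
  shows "(const D * e1 ^ k + const C * e2 * e1 ^ (k - 1)) * (\<Prod>i<L. s i)
    - e2 * debt t u L k \<in> sym_nonneg"
  using assms
proof (induction L arbitrary: k D C)
  case 0
  then have D: "0 \<le> D" "0 \<le> C" by (auto simp: admissible_def)
  show ?case
  proof (cases "3 \<le> k")
    case True
    then have C: "0 \<le> C - 1" using 0 by (simp add: admissible_def)
    have "const C = const (C - 1) + 1" using const_add[of "C - 1" 1] by simp
    then have "(const D * e1 ^ k + const C * e2 * e1 ^ (k - 1)) * (\<Prod>i<0. s i)
        - e2 * debt t u 0 k = const D * e1 ^ k + const (C - 1) * e2 * e1 ^ (k - 1)"
      using True by (simp add: algebra_simps)
    also have "\<dots> \<in> sym_nonneg" using D C by (intro sym_nonneg_intros)
    finally show ?thesis .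
  next
    case False
    then have "(const D * e1 ^ k + const C * e2 * e1 ^ (k - 1)) * (\<Prod>i<0. s i)
        - e2 * debt t u 0 k = const D * e1 ^ k + const C * e2 * e1 ^ (k - 1)" by simp
    also have "\<dots> \<in> sym_nonneg" using D by (intro sym_nonneg_intros)
    finally show ?thesis .
  qed
next
  case (Suc L)
  let ?P = "\<Prod>i<L. s i"
  let ?A = "const D * e1 ^ k + const C * e2 * e1 ^ (k - 1)"
  note adm = Suc.prems(2)
  have D: "0 \<le> D" "0 \<le> C" using adm by (auto simp: admissible_def)
  have P: "?P \<in> sym_nonneg"
    using Suc.prems(1) leg_sym_nonneg by (intro sym_nonneg_prod) (meson lessThan_iff less_SucI)
  have IH: "(const D' * e1 ^ k' + const C' * e2 * e1 ^ (k' - 1)) * ?P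
      - e2 * debt t u L k' \<in> sym_nonneg" if "admissible k' D' C'" for k' D' C'
    using Suc.IH[OF _ that] Suc.prems(1) by simp
  have "?A * ?P * a - e2 * (b * debt t u L k + c * debt t u L (Suc k)) \<in> sym_nonneg"
    if "leg a b c" for a b c
    using that
  proof (induction rule: leg.induct)
    case (unit w)
    have "w * (?A * ?P - e2 * debt t u L k) \<in> sym_nonneg"
      using IH[OF adm] unit by (intro sym_nonneg_intros)
    then show ?case by (simp add: algebra_simps)
  next
    case (linear w d c)
    \<comment> \<open>At \<open>k = 0\<close> the exponent \<open>k - 1\<close> is truncated to 0,
      which \<open>C = 0\<close> makes harmless.\<close>
    have *: "C = 0 \<or> e1 ^ k = e1 * e1 ^ (k - 1)"
      using adm by (cases k) (auto simp: admissible_def)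
    have "?A * ?P * ((const d * e1 + const c * e2) * w) - e2 * (w * debt t u L (Suc k)) =
        w * ((const (D * d) * e1 ^ Suc k + const (C * d + D * c) * e2 * e1 ^ (Suc k - 1)) * ?P
          - e2 * debt t u L (Suc k)) + w * (const (C * c) * e2 * e2 * e1 ^ (k - 1) * ?P)"
      using * by (auto simp: const_add const_mult algebra_simps)
    also have "\<dots> \<in> sym_nonneg"
    proof (rule sym_nonneg.add)
      show "w * ((const (D * d) * e1 ^ Suc k + const (C * d + D * c) * e2 * e1 ^ (Suc k - 1)) * ?P
          - e2 * debt t u L (Suc k)) \<in> sym_nonneg"
        by (intro sym_nonneg.mult IH admissible_Suc) (use adm linear in auto)
      show "w * (const (C * c) * e2 * e2 * e1 ^ (k - 1) * ?P) \<in> sym_nonneg"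
        using linear D P by (intro sym_nonneg_intros) auto
    qed
    finally show ?case by simp
  next
    case (surplus w)
    have "?A * ?P * w \<in> sym_nonneg"
      using surplus P D by (intro sym_nonneg_intros)
    then show ?case by simp
  next
    case (add a b c a' b' c')
    from sym_nonneg.add[OF add.IH] show ?case by (simp add: algebra_simps)
  qed
  from this[OF Suc.prems(1)[of L]] show ?case by (simp add: algebra_simps)
qed

text \<open>Expanding the last factor yields the instances \<open>k\<close> and
  \<open>Suc k\<close>, exactly as in the recursion of \<open>debt\<close>.\<close>

lemma dominant_with_debt:
  assumes "\<And>i. i < L \<Longrightarrow> t i \<in> sym_nonneg \<and> u i \<in> sym_nonneg"
  shows "dominant (Y\<^sup>2 * X ^ k * (\<Prod>i<L. t i + X * u i) + Y * e2 * debt t u L k)"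
  using assms
proof (induction L arbitrary: k)
  case 0
  then show ?case using dominant_Y2_X_power[of k] by (simp add: if_distrib cong: if_cong)
next
  case (Suc L)
  have "Y\<^sup>2 * X ^ k * (\<Prod>i<Suc L. t i + X * u i) + Y * e2 * debt t u (Suc L) k =
      t L * (Y\<^sup>2 * X ^ k * (\<Prod>i<L. t i + X * u i) + Y * e2 * debt t u L k)
      + u L * (Y\<^sup>2 * X ^ Suc k * (\<Prod>i<L. t i + X * u i) + Y * e2 * debt t u L (Suc k))"
    by (simp add: algebra_simps)
  moreover have "t L \<in> sym_nonneg" "u L \<in> sym_nonneg"
    and "\<And>k. dominant (Y\<^sup>2 * X ^ k * (\<Prod>i<L. t i + X * u i) + Y * e2 * debt t u L k)"
    using Suc by simp_all
  ultimately show ?case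
    by (simp only: dominant_add dominant_sym_nonneg_mult)
qed

text \<open>The debt is taken from the first summand and given to the second, which leaves both
  dominant.\<close>

lemma dominant_legs:
  fixes s t u :: "nat \<Rightarrow> bipoly"
  assumes legs: "\<And>i. i < L \<Longrightarrow> leg (s i) (t i) (u i)"
  shows "dominant (Y * (\<Prod>i<L. s i) + Y\<^sup>2 * (\<Prod>i<L. t i + X * u i))"
proof -
  have "admissible 0 1 0" by (simp add: admissible_def)
  from debt_paid[OF legs this]
  have "(\<Prod>i<L. s i) - e2 * debt t u L 0 \<in> sym_nonneg" by simp
  then have "dominant (((\<Prod>i<L. s i) - e2 * debt t u L 0) * Y ^ 1)"
    by (rule dominant_sym_nonneg_mult) (rule dominant_Y_power)
  moreover have "dominant (Y\<^sup>2 * X ^ 0 * (\<Prod>i<L. t i + X * u i) + Y * e2 * debt t u L 0)"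
    using legs leg_sym_nonneg by (intro dominant_with_debt) blast
  ultimately have "dominant (((\<Prod>i<L. s i) - e2 * debt t u L 0) * Y ^ 1
      + (Y\<^sup>2 * X ^ 0 * (\<Prod>i<L. t i + X * u i) + Y * e2 * debt t u L 0))"
    by (rule dominant_add)
  then show ?thesis by (simp add: algebra_simps)
qed

section \<open>Path polynomials\<close>

text \<open>\<open>fib_poly t (Suc k)\<close> is the independence polynomial \<open>F\<^sub>k\<close>; the index is shifted because
  \<open>F\<^bsub>-1\<^esub> = 1\<close> is needed.\<close>

fun fib_poly :: "'a::comm_ring_1 \<Rightarrow> nat \<Rightarrow> 'a" where
  "fib_poly t 0 = 1"
| "fib_poly t (Suc 0) = 1"
| "fib_poly t (Suc (Suc n)) = fib_poly t (Suc n) + t * fib_poly t n"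

definition fib_sq :: "nat \<Rightarrow> bipoly" where
  "fib_sq n = fib_poly X n * fib_poly Y n"

text \<open>\<open>fib_sq\<close>, \<open>fib_fst\<close> and \<open>fib_snd\<close> are the factors
  S, T and U of a leg.\<close>

fun fib_fst :: "nat \<Rightarrow> bipoly" where
  "fib_fst 0 = 0"
| "fib_fst (Suc 0) = 1"
| "fib_fst (Suc (Suc n)) = fib_sq (Suc n) + e2 * fib_fst n"

fun fib_snd :: "nat \<Rightarrow> bipoly" where
  "fib_snd 0 = 0"
| "fib_snd (Suc 0) = 0"
| "fib_snd (Suc (Suc n)) = fib_sq n + e2 * fib_snd n"

text \<open>Unfolding both factors returns \<open>e2\<close> times the mixed product two indices
  lower, which is the recursion of \<open>fib_fst\<close> and \<open>fib_snd\<close>.\<close>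

lemma fib_poly_mixed:
  "fib_poly X (Suc n) * fib_poly Y n = fib_fst (Suc n) + X * fib_snd (Suc n)"
  "fib_poly Y (Suc n) * fib_poly X n = fib_fst (Suc n) + Y * fib_snd (Suc n)"
proof (induction n rule: fib_fst.induct)
  case (3 n)
  have *: "fib_poly X (Suc (Suc (Suc n))) * fib_poly Y (Suc (Suc n)) =
      fib_sq (Suc (Suc n)) + X * fib_sq (Suc n) + e2 * (fib_poly X (Suc n) * fib_poly Y n)"
    "fib_poly Y (Suc (Suc (Suc n))) * fib_poly X (Suc (Suc n)) =
      fib_sq (Suc (Suc n)) + Y * fib_sq (Suc n) + e2 * (fib_poly Y (Suc n) * fib_poly X n)"
    by (simp_all add: fib_sq_def e2_def algebra_simps)
  show "fib_poly X (Suc (Suc (Suc n))) * fib_poly Y (Suc (Suc n)) =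
      fib_fst (Suc (Suc (Suc n))) + X * fib_snd (Suc (Suc (Suc n)))"
    "fib_poly Y (Suc (Suc (Suc n))) * fib_poly X (Suc (Suc n)) =
      fib_fst (Suc (Suc (Suc n))) + Y * fib_snd (Suc (Suc (Suc n)))"
    unfolding * 3 by (simp_all add: algebra_simps)
qed (simp_all add: fib_sq_def)

text \<open>The expansion contains mixed products, made symmetric by \<open>fib_poly_mixed\<close>.
  The surplus of S over \<open>T + e1 * U\<close> is the source of all terms
  \<open>c * e2\<close>.\<close>

lemma fib_sq_rec:
  "fib_sq (Suc (Suc n)) =
    fib_fst (Suc (Suc n)) + e1 * fib_snd (Suc (Suc n)) + e2 * (fib_sq n + fib_fst n)"
proof (cases n)
  case 0
  then show ?thesis by (simp add: fib_sq_def e1_def e2_def algebra_simps)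
next
  case (Suc m)
  have "fib_sq (Suc (Suc n)) = fib_sq (Suc n) + e2 * fib_sq n
      + X * (fib_poly X n * fib_poly Y (Suc n)) + Y * (fib_poly Y n * fib_poly X (Suc n))"
    by (simp add: fib_sq_def e2_def algebra_simps)
  also have "X * (fib_poly X n * fib_poly Y (Suc n)) = X * fib_sq n + e2 * (fib_poly X (Suc m) * fib_poly Y m)"
    by (simp add: Suc fib_sq_def e2_def algebra_simps)
  also have "Y * (fib_poly Y n * fib_poly X (Suc n)) = Y * fib_sq n + e2 * (fib_poly Y (Suc m) * fib_poly X m)"
    by (simp add: Suc fib_sq_def e2_def algebra_simps)
  finally show ?thesis
    unfolding fib_poly_mixed by (simp add: Suc e1_def algebra_simps)
qed

lemma fib_sym_nonneg: "fib_sq n \<in> sym_nonneg \<and> fib_fst n \<in> sym_nonneg \<and> fib_snd n \<in> sym_nonneg"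
proof (induction n rule: less_induct)
  case (less n)
  show ?case
  proof (cases n rule: fib_fst.cases)
    case (3 m)
    then have "fib_sq m \<in> sym_nonneg" "fib_fst m \<in> sym_nonneg" "fib_snd m \<in> sym_nonneg"
      "fib_sq (Suc m) \<in> sym_nonneg"
      using less by auto
    then have "fib_fst n \<in> sym_nonneg" "fib_snd n \<in> sym_nonneg" "fib_sq n \<in> sym_nonneg"
      using 3 by (auto simp: fib_sq_rec intro!: sym_nonneg_intros)
    then show ?thesis by simp
  qed (auto simp: fib_sq_def intro!: sym_nonneg_intros)
qed

section \<open>Splitting \<open>fib_snd\<close> into linear pieces\<close>

fun fib_sq_prev :: "nat \<Rightarrow> bipoly" where
  "fib_sq_prev 0 = 0"
| "fib_sq_prev (Suc 0) = 0"
| "fib_sq_prev (Suc (Suc n)) = fib_sq n"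

text \<open>A quarter of it, times \<open>e1\<close>, is the cost of raising the weights
  \<open>d\<close> from 1 to \<open>1 + r / 4\<close>.\<close>

fun fib_excess :: "nat \<Rightarrow> bipoly" where
  "fib_excess 0 = 0"
| "fib_excess (Suc 0) = 0"
| "fib_excess (Suc (Suc n)) = e2 * (fib_excess n + 2 * fib_snd n)"

text \<open>This puts the pieces \<open>D\<^sub>r\<close> used below into
  \<open>sym_nonneg\<close>.\<close>

lemma fib_sq_step_sym_nonneg: "fib_sq n - e2 * fib_sq_prev n \<in> sym_nonneg"
proof (cases n rule: fib_sq_prev.cases)
  case (3 m)
  then have "fib_sq n - e2 * fib_sq_prev n = fib_fst n + e1 * fib_snd n + e2 * fib_fst m"
    by (simp add: fib_sq_rec algebra_simps)
  then show ?thesis by (simp add: fib_sym_nonneg sym_nonneg_intros)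
qed (simp_all add: fib_sym_nonneg)

text \<open>Multiplied by \<open>e2 / 4\<close>, it bounds the cost of the weights \<open>d\<close>
  by half of the surplus \<open>e2 * fib_sq n\<close>. In the induction step the terms
  \<open>e1 * fib_snd\<close> cancel.\<close>

lemma fib_excess_bound: "2 * fib_sq n - e1 * (fib_excess n + 2 * fib_snd n) \<in> sym_nonneg"
proof (induction n rule: fib_excess.induct)
  case (3 n)
  have "2 * fib_sq (Suc (Suc n)) - e1 * (fib_excess (Suc (Suc n)) + 2 * fib_snd (Suc (Suc n))) =
      2 * fib_fst (Suc (Suc n)) + 2 * e2 * fib_fst n
      + e2 * (2 * fib_sq n - e1 * (fib_excess n + 2 * fib_snd n))"
    by (simp add: fib_sq_rec algebra_simps)
  then show ?case using 3 by (simp only:) (intro sym_nonneg_intros; simp add: fib_sym_nonneg del: fib_fst.simps)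
qed (simp_all add: fib_sym_nonneg sym_nonneg_intros)

lemma const_quarter: "4 * const (1 / 4) = 1"
  using const_mult[of 4 "1 / 4"] const_of_nat[of 4] by simp

text \<open>With \<open>D\<^sub>r = e\<^sub>2\<^sup>r (fib_sq (n - 2 - 2 r) - e\<^sub>2 fib_sq (n - 4 - 2 r))\<close> one has
  \<open>fib_snd n = \<Sum>\<^sub>r (r + 1) D\<^sub>r\<close>, \<open>fib_sq_prev n = \<Sum>\<^sub>r D\<^sub>r\<close> and \<open>fib_excess n = \<Sum>\<^sub>r r (r + 1) D\<^sub>r\<close>.
  The piece \<open>(r + 1) D\<^sub>r\<close> is given the weights \<open>d = 1 + r / 4\<close> and \<open>c = 1 / (2 (r + 1))\<close>. The
  parameter \<open>s\<close> shifts \<open>r\<close> to \<open>r + s\<close>, as required by the recursion.\<close>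

lemma leg_fib_snd:
  "leg (e1 * (fib_snd n + of_nat s * fib_sq_prev n)
      + const (1 / 4) * (2 * e2 * fib_sq_prev n
          + e1 * (fib_excess n + 2 * of_nat s * fib_snd n + (of_nat (s * s) - of_nat s) * fib_sq_prev n)))
    0 (fib_snd n + of_nat s * fib_sq_prev n)"
proof (induction n arbitrary: s rule: fib_excess.induct)
  case (3 n)
  let ?q = "const (1 / 4)" and ?w = "of_nat (Suc s) * (fib_sq n - e2 * fib_sq_prev n)"
  let ?d = "1 + real s / 4" and ?c = "1 / (2 * (1 + real s))"
  have "?w \<in> sym_nonneg"
    by (intro sym_nonneg_intros fib_sq_step_sym_nonneg)
  moreover have "1 \<le> 3 * ?c * ?d\<^sup>2"
  proof -
    \<comment> \<open>Clearing denominators leaves \<open>3 s^2 - 8 s + 16 \<ge> 0\<close>, a third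
      of this expression.\<close>
    have "0 \<le> (3 * real s - 4)\<^sup>2 + 32" by simp
    then show ?thesis by (simp add: field_simps power2_eq_square)
  qed
  ultimately have "leg ((const ?d * e1 + const ?c * e2) * ?w) 0 ?w"
    by (intro leg.linear) auto
  \<comment> \<open>\<open>?w\<close> is the piece \<open>r = 0\<close>; the pieces
    \<open>r \<ge> 1\<close> are \<open>e2\<close> times those of \<open>n\<close>, with the shift
    raised to \<open>Suc s\<close>.\<close>
  from leg.add[OF this leg_sym_nonneg_mult[OF 3[of "Suc s"] sym_nonneg.e2]]
  have leg: "leg ((const ?d * e1 + const ?c * e2) * ?w
      + e2 * (e1 * (fib_snd n + of_nat (Suc s) * fib_sq_prev n)
      + ?q * (2 * e2 * fib_sq_prev n
          + e1 * (fib_excess n + 2 * of_nat (Suc s) * fib_snd n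
              + (of_nat (Suc s * Suc s) - of_nat (Suc s)) * fib_sq_prev n))))
    (0 + e2 * 0) (?w + e2 * (fib_snd n + of_nat (Suc s) * fib_sq_prev n))" .
  have d: "const ?d = 1 + ?q * of_nat s"
    using const_mult[of "1 / 4" "real s"] by (simp add: const_add const_of_nat)
  have "const ?c * of_nat (Suc s) = const (?c * real (Suc s))"
    by (simp only: const_mult const_of_nat)
  also have "?c * real (Suc s) = 1 / 4 * 2" by (simp add: field_simps)
  also have "const (1 / 4 * 2) = ?q * 2"
    using const_of_nat[of 2] by (simp only: const_mult) simp
  finally have c: "const ?c * ?w = ?q * 2 * (fib_sq n - e2 * fib_sq_prev n)"
    by (simp only: mult.assoc[symmetric])
  have eq: "(const ?d * e1 + const ?c * e2) * ?w = (1 + ?q * of_nat s) * e1 * ?w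
      + e2 * (?q * 2 * (fib_sq n - e2 * fib_sq_prev n))"
    unfolding d c[symmetric] by (simp only: algebra_simps)
  show ?case
    using leg unfolding eq by (simp add: algebra_simps)
qed (simp_all add: leg.surplus sym_nonneg_0)

text \<open>The surplus \<open>e2 * fib_sq n\<close> is cut into quarters: two pay for the terms
  \<open>c * e2\<close>, the other two, by \<open>fib_excess_bound\<close>, for
  \<open>d - 1\<close>.\<close>

lemma leg_fib: "leg (fib_sq (Suc b)) (fib_fst (Suc b)) (fib_snd (Suc b))"
proof (cases b)
  case 0
  then show ?thesis using leg.unit[OF sym_nonneg_1] by (simp add: fib_sq_def)
next
  case (Suc n)
  let ?q = "const (1 / 4)" and ?r = "2 * fib_sq n - e1 * (fib_excess n + 2 * fib_snd n)"
  have "e2 * fib_fst n + ?q * e2 * ?r \<in> sym_nonneg"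
    by (intro sym_nonneg_intros fib_excess_bound) (simp_all add: fib_sym_nonneg)
  then have s: "leg (e2 * fib_fst n + ?q * e2 * ?r) 0 0" by (rule leg.surplus)
  have u: "leg (fib_fst (Suc b)) (fib_fst (Suc b)) 0"
    by (intro leg.unit) (simp add: fib_sym_nonneg)
  from leg.add[OF leg.add[OF u s] leg_fib_snd[of "Suc b" 0]]
  have "leg (fib_fst (Suc b) + (e2 * fib_fst n + ?q * e2 * ?r)
      + (e1 * fib_snd (Suc b) + ?q * (2 * e2 * fib_sq n + e1 * (e2 * (fib_excess n + 2 * fib_snd n)))))
      (fib_fst (Suc b)) (fib_snd (Suc b))"
    by (simp add: Suc)
  moreover have "fib_fst (Suc b) + (e2 * fib_fst n + ?q * e2 * ?r)
      + (e1 * fib_snd (Suc b) + ?q * (2 * e2 * fib_sq n + e1 * (e2 * (fib_excess n + 2 * fib_snd n))))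
      = fib_fst (Suc b) + e1 * fib_snd (Suc b) + e2 * fib_fst n + 4 * ?q * (e2 * fib_sq n)"
    by (simp add: algebra_simps)
  ultimately show ?thesis
    by (simp add: Suc fib_sq_rec const_quarter algebra_simps)
qed

section \<open>Log-concavity from dominance\<close>

definition in_X :: "real poly \<Rightarrow> bipoly" where "in_X p = [:p:]"
definition in_Y :: "real poly \<Rightarrow> bipoly" where "in_Y p = map_poly (\<lambda>c. [:c:]) p"

lemma in_X_1 [simp]: "in_X 1 = 1"
  by (simp add: in_X_def)

lemma in_X_add: "in_X (p + q) = in_X p + in_X q"
  by (simp add: in_X_def)

lemma in_X_mult: "in_X (p * q) = in_X p * in_X q"
  by (simp add: in_X_def)

lemma in_X_prod: "in_X (prod f A) = (\<Prod>i\<in>A. in_X (f i))"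
  by (induction A rule: infinite_finite_induct) (simp_all add: in_X_mult)

lemma coeff_in_Y [simp]: "coeff (in_Y p) n = [:coeff p n:]"
  by (simp add: in_Y_def coeff_map_poly)

lemma in_Y_1 [simp]: "in_Y 1 = 1"
  by (simp only: in_Y_def map_poly_1 pCons_one)

lemma in_Y_add: "in_Y (p + q) = in_Y p + in_Y q"
  by (rule poly_eqI) simp

lemma pCons_0_sum: "[:sum f A:] = (\<Sum>i\<in>A. [:f i:])"
proof (induction A rule: infinite_finite_induct)
  case (insert a A)
  have "[:f a + sum f A:] = [:f a:] + [:sum f A:]" by simp
  with insert show ?case by (simp del: add_pCons)
qed simp_all

lemma in_Y_mult: "in_Y (p * q) = in_Y p * in_Y q"
proof (rule poly_eqI)
  fix n
  have "coeff (in_Y p * in_Y q) n = (\<Sum>i\<le>n. [:coeff p i:] * [:coeff q (n - i):])"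
    unfolding coeff_mult coeff_in_Y ..
  also have "\<dots> = (\<Sum>i\<le>n. [:coeff p i * coeff q (n - i):])"
    by (intro sum.cong refl) (simp add: mult.commute)
  finally show "coeff (in_Y (p * q)) n = coeff (in_Y p * in_Y q) n"
    unfolding coeff_in_Y coeff_mult[of p q] pCons_0_sum ..
qed

lemma in_Y_prod: "in_Y (prod f A) = (\<Prod>i\<in>A. in_Y (f i))"
  by (induction A rule: infinite_finite_induct) (simp_all add: in_Y_mult)

lemma in_Y_pCons_0: "in_Y (pCons 0 p) = Y * in_Y p"
  by (rule poly_eqI) (simp add: Y_def coeff_pCons split: nat.split)

lemma in_X_t: "in_X [:0, 1:] = X"
  by (simp add: in_X_def X_def)

lemma in_Y_t: "in_Y [:0, 1:] = Y"
  using in_Y_pCons_0[of 1] by (simp add: pCons_one)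

lemma in_X_fib_poly: "in_X (fib_poly t n) = fib_poly (in_X t) n"
  by (induction t n rule: fib_poly.induct) (simp_all add: in_X_add in_X_mult)

lemma in_Y_fib_poly: "in_Y (fib_poly t n) = fib_poly (in_Y t) n"
  by (induction t n rule: fib_poly.induct) (simp_all add: in_Y_add in_Y_mult)

lemma in_X_linear: "in_X [:1, of_nat m:] = 1 + X * of_nat m"
  and in_Y_linear: "in_Y [:1, of_nat m:] = 1 + Y * of_nat m"
proof -
  have "[:1, of_nat m:] = 1 + [:0, 1:] * [:real m:]"
    by (rule poly_eqI) (simp add: coeff_pCons split: nat.split)
  moreover have "in_X [:real m:] = of_nat m" "in_Y [:real m:] = of_nat m"
    by (simp_all add: in_X_def in_Y_def map_poly_pCons const_def flip: const_of_nat)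
  ultimately show "in_X [:1, of_nat m:] = 1 + X * of_nat m"
    "in_Y [:1, of_nat m:] = 1 + Y * of_nat m"
    by (simp_all only: in_X_t in_Y_t in_X_add in_X_mult in_X_1 in_Y_add in_Y_mult in_Y_1)
qed

lemma dominant_in_X_in_Y:
  assumes "dominant (in_X p * in_Y q)" and "i < j"
  shows "coeff p j * coeff q i \<le> coeff p i * coeff q j"
proof -
  have "coeff2 (in_X p * in_Y q) (int a) (int b) = coeff p a * coeff q b" for a b
    by (simp add: coeff2_def in_X_def mult.commute)
  then show ?thesis using dominantD[OF assms(1), of "int i" "int j"] assms(2) by simp
qed

text \<open>In powers of \<open>Y\<close> every term of the expansion is already dominant, so
  nothing has to be compensated.\<close>

lemma dominant_X_Y_prods:
  fixes t u :: "nat \<Rightarrow> bipoly"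
  assumes "\<And>i. i < L \<Longrightarrow> t i \<in> sym_nonneg \<and> u i \<in> sym_nonneg"
  shows "dominant (Y ^ k * (\<Prod>i<L. t i + Y * u i))"
  using assms
proof (induction L arbitrary: k)
  case 0
  then show ?case by (simp add: dominant_Y_power)
next
  case (Suc L)
  have "Y ^ k * (\<Prod>i<Suc L. t i + Y * u i) =
      t L * (Y ^ k * (\<Prod>i<L. t i + Y * u i)) + u L * (Y ^ Suc k * (\<Prod>i<L. t i + Y * u i))"
    by (simp add: algebra_simps)
  then show ?case
    using Suc by (simp only: dominant_add dominant_sym_nonneg_mult lessI less_SucI)
qed

text \<open>The clique factor \<open>1 + m t\<close> acts as one more leg, with \<open>d = 1\<close>
  and \<open>c = m\<close>; \<open>m = 0\<close> would violate
  \<open>1 \<le> 3 * c * d\<^sup>2\<close> and is a unit instead.\<close>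

lemma leg_linear_factor:
  "leg ((1 + X * of_nat m) * (1 + Y * of_nat m)) 1 (of_nat m)"
proof (cases "m = 0")
  case True
  then show ?thesis using leg.unit[OF sym_nonneg_1] by simp
next
  case False
  then have "1 \<le> 3 * real m * 1\<^sup>2" by simp
  from leg.add[OF leg.unit[OF sym_nonneg_1] leg.linear[OF sym_nonneg_of_nat[of m] _ _ this]]
  have "leg (1 + (e1 + of_nat m * e2) * of_nat m) 1 (of_nat m)"
    by (simp add: const_of_nat)
  then show ?thesis by (simp add: e1_def e2_def algebra_simps)
qed

text \<open>With \<open>I_j = B_j + A_(j-1)\<close>, splitting \<open>I_(k+2)\<close> in
  \<open>I_k I_(k+2)\<close> gives three products, whose bounds add up to
  \<open>(B_(k+1) + A_k) I_(k+1)\<close>.\<close>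

lemma dominant_imp_log_concave:
  fixes A B :: "real poly"
  assumes BI: "dominant (in_X B * in_Y (pCons 0 (B + pCons 0 A)))"
    and AB: "dominant (in_X A * in_Y B)" and AA: "dominant (in_X A * in_Y (pCons 0 A))"
  shows "coeff (B + pCons 0 A) k * coeff (B + pCons 0 A) (Suc (Suc k))
    \<le> (coeff (B + pCons 0 A) (Suc k))\<^sup>2"
proof -
  have "coeff B (Suc (Suc k)) * (coeff B k + coeff (pCons 0 A) k)
      \<le> coeff B (Suc k) * (coeff B (Suc k) + coeff A k)"
    using dominant_in_X_in_Y[OF BI, of "Suc k" "Suc (Suc k)"] by simp
  moreover have "coeff A (Suc k) * coeff B k \<le> coeff A k * coeff B (Suc k)"
    using dominant_in_X_in_Y[OF AB, of k "Suc k"] by simp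
  moreover have "coeff A (Suc k) * coeff (pCons 0 A) k \<le> coeff A k * coeff A k"
    using dominant_in_X_in_Y[OF AA, of k "Suc k"] by simp
  ultimately show ?thesis
    by (simp add: power2_eq_square algebra_simps)
qed

lemma fib_prods_log_concave:
  fixes l :: "nat \<Rightarrow> nat" and L m :: nat and A B :: "real poly"
  defines "A \<equiv> \<Prod>i<L. fib_poly [:0, 1:] (l i)"
    and "B \<equiv> [:1, of_nat m:] * (\<Prod>i<L. fib_poly [:0, 1:] (Suc (l i)))"
  shows "coeff (B + pCons 0 A) k * coeff (B + pCons 0 A) (Suc (Suc k))
    \<le> (coeff (B + pCons 0 A) (Suc k))\<^sup>2"
proof (rule dominant_imp_log_concave)
  have prod: "(\<Prod>i<Suc L. if i = L then a else f i) = (\<Prod>i<L. f i) * a" for a :: bipoly and f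
    by simp
  have XA: "in_X A = (\<Prod>i<L. fib_poly X (l i))" and YA: "in_Y A = (\<Prod>i<L. fib_poly Y (l i))"
    by (simp_all add: A_def in_X_prod in_Y_prod in_X_fib_poly in_Y_fib_poly in_X_t in_Y_t)
  have XB: "in_X B = (1 + X * of_nat m) * (\<Prod>i<L. fib_poly X (Suc (l i)))"
    and YB: "in_Y B = (1 + Y * of_nat m) * (\<Prod>i<L. fib_poly Y (Suc (l i)))"
    unfolding B_def in_X_mult in_Y_mult in_X_linear in_Y_linear in_X_prod in_Y_prod
      in_X_fib_poly in_Y_fib_poly in_X_t in_Y_t by simp_all
  \<comment> \<open>Index \<open>L\<close>, after the legs, holds the clique factor.\<close>
  define s where "s = (\<lambda>i. if i = L then (1 + X * of_nat m) * (1 + Y * of_nat m) else fib_sq (Suc (l i)))"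
  define t where "t = (\<lambda>i. if i = L then 1 else fib_fst (Suc (l i)))"
  define u where "u = (\<lambda>i. if i = L then of_nat m else fib_snd (Suc (l i)))"
  have leg: "leg (s i) (t i) (u i)" for i
    by (simp add: s_def t_def u_def leg_linear_factor leg_fib)
  have S: "(\<Prod>i<Suc L. s i) = in_X B * in_Y B"
    by (simp add: s_def XB YB fib_sq_def prod.distrib algebra_simps)
  have TX: "(\<Prod>i<Suc L. t i + X * u i) = in_X B * in_Y A"
  proof -
    have "(\<Prod>i<Suc L. t i + X * u i) =
        (\<Prod>i<L. fib_fst (Suc (l i)) + X * fib_snd (Suc (l i))) * (1 + X * of_nat m)"
      by (simp add: t_def u_def)
    then show ?thesis
      by (simp only: fib_poly_mixed(1)[symmetric] prod.distrib XB YA mult_ac)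
  qed
  have TY: "(\<Prod>i<Suc L. t i + Y * u i) = in_X A * in_Y B"
  proof -
    have "(\<Prod>i<Suc L. t i + Y * u i) =
        (\<Prod>i<L. fib_fst (Suc (l i)) + Y * fib_snd (Suc (l i))) * (1 + Y * of_nat m)"
      by (simp add: t_def u_def)
    then show ?thesis
      by (simp only: fib_poly_mixed(2)[symmetric] prod.distrib XA YB mult_ac)
  qed
  have "Y * (in_X B * in_Y B) + Y\<^sup>2 * (in_X B * in_Y A) = in_X B * in_Y (pCons 0 (B + pCons 0 A))"
    by (simp add: in_Y_pCons_0 in_Y_add power2_eq_square algebra_simps)
  then show "dominant (in_X B * in_Y (pCons 0 (B + pCons 0 A)))"
    using dominant_legs[of "Suc L" s t u] leg unfolding S TX by simp
  show "dominant (in_X A * in_Y B)"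
    using dominant_X_Y_prods[of "Suc L" t u 0] leg leg_sym_nonneg unfolding TY by simp blast
  have "(\<Prod>i<L. fib_sq (l i)) \<in> sym_nonneg"
    by (rule sym_nonneg_prod) (simp add: fib_sym_nonneg)
  then have "dominant ((\<Prod>i<L. fib_sq (l i)) * Y ^ 1)"
    by (rule dominant_sym_nonneg_mult) (rule dominant_Y_power)
  then show "dominant (in_X A * in_Y (pCons 0 A))"
    by (simp add: in_Y_pCons_0 XA YA fib_sq_def prod.distrib mult_ac)
qed

section \<open>Independence polynomials of pineapple graphs\<close>

text \<open>With vertices and arcs as separate arguments, an induced subgraph arises by shrinking
  \<open>V\<close> alone.\<close>

definition indep_sets :: "'a set \<Rightarrow> ('a \<times> 'a) set \<Rightarrow> 'a set set" where
  "indep_sets V E = {S. S \<subseteq> V \<and> (\<forall>u\<in>S. \<forall>v\<in>S. (u, v) \<notin> E)}"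

definition indep_poly :: "'a set \<Rightarrow> ('a \<times> 'a) set \<Rightarrow> real poly" where
  "indep_poly V E = (\<Sum>S\<in>indep_sets V E. monom 1 (card S))"

lemma finite_indep_sets: "finite V \<Longrightarrow> finite (indep_sets V E)"
  by (rule finite_subset[of _ "Pow V"]) (auto simp: indep_sets_def)

lemma coeff_indep_poly:
  assumes "finite V"
  shows "coeff (indep_poly V E) k = real (card {S \<in> indep_sets V E. card S = k})"
proof -
  have "coeff (indep_poly V E) k = (\<Sum>S\<in>indep_sets V E. if card S = k then 1 else 0)"
    by (simp add: indep_poly_def coeff_sum)
  also have "\<dots> = real (card {S \<in> indep_sets V E. card S = k})"
    using finite_indep_sets[OF assms] by (simp flip: sum.inter_filter)
  finally show ?thesis .
qed

lemma indep_poly_empty [simp]: "indep_poly {} E = 1"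
proof -
  have "indep_sets {} E = {{}}" by (auto simp: indep_sets_def)
  then show ?thesis by (simp add: indep_poly_def)
qed

text \<open>Independent sets are sorted by whether they contain \<open>v\<close>; those that do
  avoid its neighbours.\<close>

lemma indep_poly_insert:
  assumes V: "finite V" "v \<notin> V" and E: "sym E" "(v, v) \<notin> E"
  shows "indep_poly (insert v V) E =
    indep_poly V E + pCons 0 (indep_poly (V - {u. (v, u) \<in> E}) E)"
proof -
  let ?W = "V - {u. (v, u) \<in> E}"
  have eq: "indep_sets (insert v V) E = indep_sets V E \<union> insert v ` indep_sets ?W E"
  proof (intro equalityI subsetI)
    fix S assume S: "S \<in> indep_sets (insert v V) E"
    show "S \<in> indep_sets V E \<union> insert v ` indep_sets ?W E"
    proof (cases "v \<in> S")
      case True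
      then have "S = insert v (S - {v})" by auto
      moreover have "S - {v} \<in> indep_sets ?W E"
        using S True by (auto simp: indep_sets_def)
      ultimately show ?thesis by blast
    next
      case False
      then show ?thesis using S by (auto simp: indep_sets_def)
    qed
  next
    fix S assume "S \<in> indep_sets V E \<union> insert v ` indep_sets ?W E"
    then show "S \<in> indep_sets (insert v V) E"
      using E by (auto simp: indep_sets_def dest: symD)
  qed
  have v: "v \<notin> S" if "S \<in> indep_sets ?W E \<or> S \<in> indep_sets V E" for S
    using that V by (auto simp: indep_sets_def)
  have inj: "inj_on (insert v) (indep_sets ?W E)"
    by (intro inj_onI) (metis insert_ident v)
  have "indep_poly (insert v V) E = indep_poly V E
      + (\<Sum>S\<in>insert v ` indep_sets ?W E. monom 1 (card S))"
    unfolding indep_poly_def eq using V v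
    by (intro sum.union_disjoint) (auto simp: finite_indep_sets)
  also have "(\<Sum>S\<in>insert v ` indep_sets ?W E. monom 1 (card S)) =
      (\<Sum>S\<in>indep_sets ?W E. pCons 0 (monom (1 :: real) (card S)))"
    unfolding sum.reindex[OF inj]
  proof (rule sum.cong)
    fix S assume S: "S \<in> indep_sets ?W E"
    then have "finite S" using V by (auto simp: indep_sets_def intro: finite_subset)
    then show "((\<lambda>S. monom 1 (card S)) \<circ> insert v) S = pCons 0 (monom (1 :: real) (card S))"
      using v S by (simp add: monom_Suc)
  qed simp
  also have "\<dots> = pCons 0 (indep_poly ?W E)"
    using sum_distrib_left[of "[:0, 1:]" "\<lambda>S. monom (1 :: real) (card S)" "indep_sets ?W E"]
    by (simp add: indep_poly_def)
  finally show ?thesis .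
qed

lemma indep_poly_Un:
  assumes fin: "finite V" "finite W" and disj: "V \<inter> W = {}"
    and E: "\<And>v w. v \<in> V \<Longrightarrow> w \<in> W \<Longrightarrow> (v, w) \<notin> E \<and> (w, v) \<notin> E"
  shows "indep_poly (V \<union> W) E = indep_poly V E * indep_poly W E"
proof -
  let ?u = "\<lambda>(S, T). S \<union> T"
  have "indep_sets (V \<union> W) E \<subseteq> ?u ` (indep_sets V E \<times> indep_sets W E)"
  proof
    fix S assume S: "S \<in> indep_sets (V \<union> W) E"
    then have "S = ?u (S \<inter> V, S \<inter> W)" and "(S \<inter> V, S \<inter> W) \<in> indep_sets V E \<times> indep_sets W E"
      by (auto simp: indep_sets_def)
    then show "S \<in> ?u ` (indep_sets V E \<times> indep_sets W E)" by blast
  qed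
  moreover have "?u ` (indep_sets V E \<times> indep_sets W E) \<subseteq> indep_sets (V \<union> W) E"
    using E by (auto simp: indep_sets_def) blast+
  ultimately have eq: "indep_sets (V \<union> W) E = ?u ` (indep_sets V E \<times> indep_sets W E)" ..
  have inj: "inj_on ?u (indep_sets V E \<times> indep_sets W E)"
  proof (rule inj_on_inverseI)
    fix x assume "x \<in> indep_sets V E \<times> indep_sets W E"
    then show "(\<lambda>S. (S \<inter> V, S \<inter> W)) (?u x) = x"
      using disj by (auto simp: indep_sets_def)
  qed
  have card: "card (S \<union> T) = card S + card T" if "S \<in> indep_sets V E" "T \<in> indep_sets W E" for S T
    using that disj fin
    by (intro card_Un_disjoint) (auto simp: indep_sets_def intro: finite_subset)
  have "indep_poly (V \<union> W) E =
      (\<Sum>(S, T)\<in>indep_sets V E \<times> indep_sets W E. monom 1 (card S) * monom 1 (card T))"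
    unfolding indep_poly_def eq sum.reindex[OF inj]
    by (rule sum.cong) (auto simp: card mult_monom)
  then show ?thesis
    by (simp add: indep_poly_def sum_product sum.cartesian_product)
qed

definition leg_part :: "nat list \<Rightarrow> nat \<Rightarrow> nat \<Rightarrow> pineapple_vertex set" where
  "leg_part l a i = {Leg i j | j. a \<le> j \<and> j < l ! i}"

lemma pineapple_arcs:
  "(Leg i j, Leg i' j') \<in> parcs (pineapple n l) \<longleftrightarrow> i = i' \<and> i < length l \<and>
    (j' = Suc j \<and> Suc j < l ! i \<or> j = Suc j' \<and> Suc j' < l ! i)"
  "(Torso, Leg i j) \<in> parcs (pineapple n l) \<longleftrightarrow> i < length l \<and> j = 0 \<and> 0 < l ! i"
  "(Torso, Clique c) \<in> parcs (pineapple n l) \<longleftrightarrow> 1 \<le> c \<and> c < n"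
  "(Leg i j, Clique c) \<notin> parcs (pineapple n l)" "(Clique c, Leg i j) \<notin> parcs (pineapple n l)"
  "(Clique c, Clique d) \<in> parcs (pineapple n l) \<longleftrightarrow> c \<noteq> d \<and> 1 \<le> c \<and> c < n \<and> 1 \<le> d \<and> d < n"
  by (auto simp: pineapple_def torso_clique_def complete_graph_on_def spider_def Let_def)

lemma sym_pineapple: "sym (parcs (pineapple n l))"
proof -
  interpret pair_graph "pineapple n l" by (rule pineapple_pair_graph)
  show ?thesis using sym_arcs by (simp add: symmetric_def)
qed

lemma irrefl_pineapple: "(v, v) \<notin> parcs (pineapple n l)"
  by (auto simp: pineapple_def torso_clique_def complete_graph_on_def spider_def Let_def)

lemma finite_leg_part [simp]: "finite (leg_part l a i)"
  by (simp add: leg_part_def)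

lemma indep_poly_leg_part:
  assumes "i < length l"
  shows "indep_poly (leg_part l a i) (parcs (pineapple n l)) = fib_poly [:0, 1:] (Suc (l ! i - a))"
proof (induction "l ! i - a" arbitrary: a rule: less_induct)
  case less
  let ?E = "parcs (pineapple n l)"
  show ?case
  proof (cases "a < l ! i")
    case False
    then have "leg_part l a i = {}" by (auto simp: leg_part_def)
    with False show ?thesis by simp
  next
    case True
    let ?V = "leg_part l (Suc a) i"
    have V: "leg_part l a i = insert (Leg i a) ?V"
      using True le_eq_less_or_eq by (auto simp: leg_part_def)
    have N: "?V - {u. (Leg i a, u) \<in> ?E} = leg_part l (Suc (Suc a)) i"
      using assms by (auto simp: leg_part_def pineapple_arcs)
    have "indep_poly (leg_part l a i) ?E =
        indep_poly ?V ?E + pCons 0 (indep_poly (leg_part l (Suc (Suc a)) i) ?E)"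
      unfolding V N[symmetric]
      by (rule indep_poly_insert) (auto simp: leg_part_def sym_pineapple irrefl_pineapple)
    also have "indep_poly ?V ?E = fib_poly [:0, 1:] (Suc (l ! i - Suc a))"
      using less[of "Suc a"] True by simp
    also have "indep_poly (leg_part l (Suc (Suc a)) i) ?E = fib_poly [:0, 1:] (l ! i - Suc a)"
    proof (cases "Suc a < l ! i")
      case True
      then have "l ! i - Suc a = Suc (l ! i - Suc (Suc a))" by simp
      then show ?thesis using less[of "Suc (Suc a)"] True by simp
    next
      case False
      \<comment> \<open>\<open>Leg i a\<close> is the outermost vertex, and \<open>fib_poly\<close>
        at index 0 supplies the value 1.\<close>
      then have "leg_part l (Suc (Suc a)) i = {}" by (auto simp: leg_part_def)
      with False show ?thesis by simp
    qed
    also have "l ! i - a = Suc (l ! i - Suc a)" using True by simp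
    ultimately show ?thesis by simp
  qed
qed

lemma indep_poly_legs:
  "L \<le> length l \<Longrightarrow> indep_poly (\<Union>i<L. leg_part l a i) (parcs (pineapple n l)) =
    (\<Prod>i<L. fib_poly [:0, 1:] (Suc (l ! i - a)))"
proof (induction L)
  case (Suc L)
  let ?E = "parcs (pineapple n l)"
  have "indep_poly ((\<Union>i<L. leg_part l a i) \<union> leg_part l a L) ?E =
      indep_poly (\<Union>i<L. leg_part l a i) ?E * indep_poly (leg_part l a L) ?E"
    by (rule indep_poly_Un) (auto simp: leg_part_def pineapple_arcs)
  then show ?case
    using Suc by (simp add: lessThan_Suc Un_commute indep_poly_leg_part del: fib_poly.simps)
qed simp

lemma indep_poly_clique_part:
  "k < n \<Longrightarrow> indep_poly (Clique ` {1..k}) (parcs (pineapple n l)) = [:1, of_nat k:]"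
proof (induction k)
  case (Suc k)
  let ?E = "parcs (pineapple n l)"
  have V: "Clique ` {1..Suc k} = insert (Clique (Suc k)) (Clique ` {1..k})"
    by (auto simp: atLeastAtMostSuc_conv)
  have N: "Clique ` {1..k} - {u. (Clique (Suc k), u) \<in> ?E} = {}"
    using Suc.prems by (auto simp: pineapple_arcs)
  have "indep_poly (Clique ` {1..Suc k}) ?E =
      indep_poly (Clique ` {1..k}) ?E + pCons 0 (indep_poly {} ?E)"
    unfolding V N[symmetric] by (rule indep_poly_insert) (auto simp: sym_pineapple irrefl_pineapple)
  also have "indep_poly (Clique ` {1..k}) ?E = [:1, of_nat k:]"
    using Suc by simp
  also have "[:1, of_nat k:] + pCons 0 (indep_poly {} ?E) = [:1, of_nat (Suc k):]"
    by (rule poly_eqI) (simp add: coeff_pCons split: nat.split)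
  finally show ?case .
qed simp

lemma indep_poly_pineapple:
  assumes n: "1 \<le> n" and pos: "\<And>i. i < length l \<Longrightarrow> 1 \<le> l ! i"
  shows "indep_poly (pverts (pineapple n l)) (parcs (pineapple n l)) =
    [:1, of_nat (n - 1):] * (\<Prod>i<length l. fib_poly [:0, 1:] (Suc (l ! i)))
    + pCons 0 (\<Prod>i<length l. fib_poly [:0, 1:] (l ! i))"
proof -
  let ?E = "parcs (pineapple n l)"
  let ?K = "Clique ` {1..n - 1}" and ?L = "\<lambda>a. \<Union>i<length l. leg_part l a i"
  have "{1..<n} = {1..n - 1}" using n by auto
  then have V: "pverts (pineapple n l) = insert Torso (?K \<union> ?L 0)"
    by (auto simp: pineapple_def torso_clique_def complete_graph_on_def spider_def Let_def leg_part_def)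
  \<comment> \<open>Deleting the neighbours of the torso removes the clique and the first vertex of
    each leg.\<close>
  have N: "?K \<union> ?L 0 - {u. (Torso, u) \<in> ?E} = ?L 1"
    using n by (auto simp: leg_part_def pineapple_arcs)
  have "indep_poly (pverts (pineapple n l)) ?E =
      indep_poly (?K \<union> ?L 0) ?E + pCons 0 (indep_poly (?L 1) ?E)"
    unfolding V N[symmetric]
    by (rule indep_poly_insert) (auto simp: sym_pineapple irrefl_pineapple leg_part_def)
  also have "indep_poly (?K \<union> ?L 0) ?E = indep_poly ?K ?E * indep_poly (?L 0) ?E"
    by (rule indep_poly_Un) (auto simp: leg_part_def pineapple_arcs)
  also have "indep_poly ?K ?E = [:1, of_nat (n - 1):]"
    using n by (intro indep_poly_clique_part) simp
  also have "indep_poly (?L 0) ?E = (\<Prod>i<length l. fib_poly [:0, 1:] (Suc (l ! i)))"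
    by (subst indep_poly_legs) simp_all
  also have "indep_poly (?L 1) ?E = (\<Prod>i<length l. fib_poly [:0, 1:] (l ! i))"
  proof (subst indep_poly_legs)
    have "Suc (l ! i - 1) = l ! i" if "i < length l" for i
      using pos[OF that] by simp
    then show "(\<Prod>i<length l. fib_poly [:0, 1:] (Suc (l ! i - 1))) =
        (\<Prod>i<length l. fib_poly [:0, 1:] (l ! i))"
      by simp
  qed simp
  finally show ?thesis .
qed

theorem theorem3p5:
  fixes n :: nat and l :: "nat list"
  assumes "n \<ge> 1" and "integer_partition l"
  shows "log_concave_poly (independence_poly (pineapple n l))"
  unfolding log_concave_poly_def
proof (intro allI impI)
  fix j
  let ?G = "pineapple n l"
  interpret pair_graph ?G by (rule pineapple_pair_graph)
  let ?p = "indep_poly (pverts ?G) (parcs ?G)"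
  assume j: "1 \<le> j \<and> j < degree (independence_poly ?G)"
  then obtain k where k: "j = Suc k" by (cases j) auto
  have coeff: "real_of_int (coeff (independence_poly ?G) i) = coeff ?p i" if "i \<le> j + 1" for i
  proof -
    \<comment> \<open>Since \<open>j\<close> is below the degree, \<open>j + 1\<close> is still in
      the range of the defining sum.\<close>
    have "i \<le> independence_number ?G"
      using that j degree_independence_poly[OF pineapple_pair_graph] by simp
    then show ?thesis
      by (simp add: independence_poly_def coeff_sum coeff_indep_poly independent_sets_def indep_sets_def)
  qed
  have pos: "1 \<le> l ! i" if "i < length l" for i
    using assms(2) that by (auto simp: integer_partition_def)
  have "coeff ?p k * coeff ?p (Suc (Suc k)) \<le> (coeff ?p (Suc k))\<^sup>2"
  proof -
    have "?p = [:1, of_nat (n - 1):] * (\<Prod>i<length l. fib_poly [:0, 1:] (Suc (l ! i)))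
        + pCons 0 (\<Prod>i<length l. fib_poly [:0, 1:] (l ! i))"
      by (rule indep_poly_pineapple[OF assms(1) pos])
    then show ?thesis by (simp only: fib_prods_log_concave)
  qed
  then have "real_of_int (coeff (independence_poly ?G) (j - 1) * coeff (independence_poly ?G) (j + 1))
      \<le> real_of_int ((coeff (independence_poly ?G) j)\<^sup>2)"
    by (simp add: coeff k)
  then show "coeff (independence_poly ?G) (j - 1) * coeff (independence_poly ?G) (j + 1)
      \<le> (coeff (independence_poly ?G) j)\<^sup>2"
    by (simp only: of_int_le_iff)
qed

end
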